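(* Let $(M,g)$ be a surface of revolution, with metric $g=A^2(u^2)\,du^1\otimes du^1+du^2\otimes du^2$ ($A>0$), curvature $K=-A''/A$, and $\Sigma=\{K=0\}$ a (possibly empty) disjoint union of parallels $u^2=\mathrm{const}$. Let $C$ be a real constant, let $\gamma:(a,b)\to M$ be a solution of $$\nabla_{\frac{d\gamma}{dt}}\frac{d\gamma}{dt}=C\,K\,J(\dot\gamma)-C^2K\,\mathrm{grad}\,K ,$$ and let $I_1=\gamma^{-1}(M\setminus\Sigma)$. Write $\frac{d}{dt}\gamma(t)=Q^1(t)e_1+Q^2(t)e_2$, where $e_1=\frac1A\partial_1$, $e_2=\partial_2$. Assume that $I_1$ is dense in $(a,b)$. Then there are constants $C_2$, $C_3$ such that $$A(\gamma(t))\,Q^1(t)-C\,A'(\gamma(t))=C_2,$$ $$(Q^1(t))^2+(Q^2(t))^2+C^2K(\gamma(t))^2=C_3^2$$ for all $t\in(a,b)$.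
   Context: Here $(u^1,u^2)$ are the coordinates on the surface of revolution with $u^1$ the rotation angle (rotation by $\alpha$ is $(u^1,u^2)\mapsto(u^1+\alpha,u^2)$); everything takes place where these coordinates are defined. The superscripts in $u^1,u^2,Q^1,Q^2$ are indices, and $\partial_i=\partial/\partial u^i$. The prime denotes the derivative with respect to $u^2$, and $A(\gamma(t))$, $A'(\gamma(t))$, $K(\gamma(t))$ mean the values at the coordinate $u^2(\gamma(t))$. $\nabla$ is the Levi-Civita connection of $g$; $M$ is oriented so that the orthonormal frame $(e_1,e_2)$ is positively oriented, and $J$ is the associated complex structure, $Je_1=e_2$, $Je_2=-e_1$. *)

theory Defs
  imports "HOL-Analysis.Analysis"
begin

section \<open>Riemannian geometry in a coordinate chart\<close>

text \<open>
  A Riemannian metric is given by its matrix \<open>g u $ i $ j\<close> of components in the coordinates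
  \<open>u = (u\<^sup>1, \<dots>, u\<^sup>n)\<close>. Tangent vectors at \<open>u\<close> are given by their components with respect to
  the coordinate basis, so that \<open>\<partial>\<^sub>i\<close> is \<open>axis i 1\<close>. All operators below are local: their value at
  an interior point of the chart depends only on the germ of \<open>g\<close> there.
\<close>

definition partial_deriv :: "'n \<Rightarrow> (real^'n \<Rightarrow> real) \<Rightarrow> real^'n \<Rightarrow> real" where
  "partial_deriv i f u = deriv (\<lambda>s. f (u + s *\<^sub>R axis i 1)) 0"

definition metric_inner :: "(real^'n \<Rightarrow> real^'n^'n) \<Rightarrow> real^'n \<Rightarrow> real^'n \<Rightarrow> real^'n \<Rightarrow> real" where
  "metric_inner g u v w = (\<Sum>i\<in>UNIV. \<Sum>j\<in>UNIV. g u $ i $ j * v $ i * w $ j)"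

text \<open>\<open>christoffel g k i j\<close> is the symbol \<open>\<Gamma>\<^sup>k\<^sub>i\<^sub>j\<close> of the Levi-Civita connection,
  \<open>\<nabla>\<^bsub>\<partial>\<^sub>i\<^esub> \<partial>\<^sub>j = \<Sum>\<^sub>k \<Gamma>\<^sup>k\<^sub>i\<^sub>j \<partial>\<^sub>k\<close>.\<close>

definition christoffel ::
    "(real^'n \<Rightarrow> real^'n^'n) \<Rightarrow> 'n \<Rightarrow> 'n \<Rightarrow> 'n \<Rightarrow> real^'n \<Rightarrow> real" where
  "christoffel g k i j u = (1/2) * (\<Sum>l\<in>UNIV. matrix_inv (g u) $ k $ l *
     (partial_deriv i (\<lambda>x. g x $ j $ l) u + partial_deriv j (\<lambda>x. g x $ i $ l) u
      - partial_deriv l (\<lambda>x. g x $ i $ j) u))"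

definition gradient :: "(real^'n \<Rightarrow> real^'n^'n) \<Rightarrow> (real^'n \<Rightarrow> real) \<Rightarrow> real^'n \<Rightarrow> real^'n" where
  "gradient g f u = matrix_inv (g u) *v (\<chi> l. partial_deriv l f u)"

definition velocity :: "(real \<Rightarrow> real^'n) \<Rightarrow> real \<Rightarrow> real^'n" where
  "velocity \<gamma> t = vector_derivative \<gamma> (at t)"

text \<open>The covariant derivative, along the curve \<open>\<gamma>\<close>, of a vector field \<open>V\<close> along \<open>\<gamma>\<close>.\<close>

definition covariant_derivative ::
    "(real^'n \<Rightarrow> real^'n^'n) \<Rightarrow> (real \<Rightarrow> real^'n) \<Rightarrow> (real \<Rightarrow> real^'n) \<Rightarrow> real \<Rightarrow> real^'n" where
  "covariant_derivative g \<gamma> V t = vector_derivative V (at t) +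
     (\<chi> k. \<Sum>i\<in>UNIV. \<Sum>j\<in>UNIV. christoffel g k i j (\<gamma> t) * velocity \<gamma> t $ i * V t $ j)"

text \<open>\<open>riemann g l k i j\<close> is the \<open>\<partial>\<^sub>l\<close>-component of \<open>R(\<partial>\<^sub>i,\<partial>\<^sub>j)\<partial>\<^sub>k\<close>, where
  \<open>R(X,Y)Z = \<nabla>\<^sub>X \<nabla>\<^sub>Y Z - \<nabla>\<^sub>Y \<nabla>\<^sub>X Z - \<nabla>\<^bsub>[X,Y]\<^esub> Z\<close>; in dimension two the Gaussian curvature is
  \<open>\<langle>R(\<partial>\<^sub>1,\<partial>\<^sub>2)\<partial>\<^sub>2, \<partial>\<^sub>1\<rangle> / det g\<close>.\<close>

definition riemann ::
    "(real^'n \<Rightarrow> real^'n^'n) \<Rightarrow> 'n \<Rightarrow> 'n \<Rightarrow> 'n \<Rightarrow> 'n \<Rightarrow> real^'n \<Rightarrow> real" where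
  "riemann g l k i j u =
     partial_deriv i (christoffel g l j k) u - partial_deriv j (christoffel g l i k) u
     + (\<Sum>m\<in>UNIV. christoffel g l i m u * christoffel g m j k u
               - christoffel g l j m u * christoffel g m i k u)"

definition gaussian_curvature :: "(real^2 \<Rightarrow> real^2^2) \<Rightarrow> real^2 \<Rightarrow> real" where
  "gaussian_curvature g u = (\<Sum>l\<in>UNIV. g u $ 1 $ l * riemann g l 2 1 2 u) / det (g u)"


section \<open>Surfaces of revolution\<close>

text \<open>
  The second coordinate of points ranges over an open interval \<open>I\<close>. The first one is the rotation
  angle, taken as a real number and not modulo \<open>2 * pi\<close>; thus curves are described by a continuous
  choice of their angle, and rotations act by translation of the first coordinate.
\<close>

definition smooth_real_on :: "real set \<Rightarrow> (real \<Rightarrow> real) \<Rightarrow> bool" where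
  "smooth_real_on I f \<longleftrightarrow> (\<forall>n. \<forall>x\<in>I. ((deriv ^^ n) f) differentiable (at x))"

definition surface_of_revolution :: "real set \<Rightarrow> (real \<Rightarrow> real) \<Rightarrow> bool" where
  "surface_of_revolution I A \<longleftrightarrow>
     open I \<and> is_interval I \<and> I \<noteq> {} \<and> smooth_real_on I A \<and> (\<forall>x\<in>I. A x > 0)"

definition revolution_points :: "real set \<Rightarrow> (real^2) set" where
  "revolution_points I = {u. u $ 2 \<in> I}"

definition revolution_metric :: "(real \<Rightarrow> real) \<Rightarrow> real^2 \<Rightarrow> real^2^2" where
  "revolution_metric A u = vector [vector [(A (u $ 2))\<^sup>2, 0], vector [0, 1]]"

definition frame1 :: "(real \<Rightarrow> real) \<Rightarrow> real^2 \<Rightarrow> real^2" where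
  "frame1 A u = (1 / A (u $ 2)) *\<^sub>R axis 1 1"

definition frame2 :: "real^2 \<Rightarrow> real^2" where
  "frame2 u = axis 2 1"

text \<open>The complex structure: the linear map sending \<open>frame1\<close> to \<open>frame2\<close> and \<open>frame2\<close> to
  \<open>- frame1\<close>; see \<open>linear_complex_structure\<close> and \<open>complex_structure_frame\<close> below.\<close>

definition complex_structure :: "(real \<Rightarrow> real) \<Rightarrow> real^2 \<Rightarrow> real^2 \<Rightarrow> real^2" where
  "complex_structure A u v =
     metric_inner (revolution_metric A) u v (frame1 A u) *\<^sub>R frame2 u
     - metric_inner (revolution_metric A) u v (frame2 u) *\<^sub>R frame1 A u"

definition parallel :: "real \<Rightarrow> (real^2) set" where
  "parallel c = {u. u $ 2 = c}"


section \<open>Consistency of the definitions\<close>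

lemma revolution_metric_nth [simp]:
  "revolution_metric A u $ 1 $ 1 = (A (u $ 2))\<^sup>2"
  "revolution_metric A u $ 1 $ 2 = 0"
  "revolution_metric A u $ 2 $ 1 = 0"
  "revolution_metric A u $ 2 $ 2 = 1"
  by (simp_all add: revolution_metric_def)

lemma axis_2_nth [simp]:
  "(axis 1 c :: real^2) $ 1 = c" "(axis 1 c :: real^2) $ 2 = 0"
  "(axis 2 c :: real^2) $ 1 = 0" "(axis 2 c :: real^2) $ 2 = c"
  by (simp_all add: axis_def)

lemma frame_orthonormal:
  assumes "A (u $ 2) > 0"
  shows "metric_inner (revolution_metric A) u (frame1 A u) (frame1 A u) = 1"
    and "metric_inner (revolution_metric A) u (frame1 A u) (frame2 u) = 0"
    and "metric_inner (revolution_metric A) u (frame2 u) (frame1 A u) = 0"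
    and "metric_inner (revolution_metric A) u (frame2 u) (frame2 u) = 1"
  using assms by (simp_all add: metric_inner_def sum_2 frame1_def frame2_def power2_eq_square)

lemma linear_complex_structure: "linear (complex_structure A u)"
  by (rule linearI)
    (simp_all add: complex_structure_def metric_inner_def sum_2 vec_eq_iff forall_2 algebra_simps)

lemma complex_structure_frame:
  assumes "A (u $ 2) > 0"
  shows "complex_structure A u (frame1 A u) = frame2 u"
    and "complex_structure A u (frame2 u) = - frame1 A u"
  using assms by (simp_all add: complex_structure_def frame_orthonormal)

lemma revolution_metric_inv:
  assumes "A (u $ 2) > 0"
  shows "matrix_inv (revolution_metric A u) = vector [vector [1 / (A (u $ 2))\<^sup>2, 0], vector [0, 1]]"
proof -
  let ?B = "vector [vector [1 / (A (u $ 2))\<^sup>2, 0], vector [0, 1]] :: real^2^2"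
  have 1: "revolution_metric A u ** ?B = mat 1" "?B ** revolution_metric A u = mat 1"
    using assms by (simp_all add: matrix_matrix_mult_def vec_eq_iff forall_2 sum_2 mat_def)
  then have "matrix_inv (revolution_metric A u) ** revolution_metric A u = mat 1"
    unfolding matrix_inv_def
    using someI[where x = ?B and P = "\<lambda>B. revolution_metric A u ** B = mat 1 \<and> B ** revolution_metric A u = mat 1"]
    by blast
  then have "matrix_inv (revolution_metric A u) ** (revolution_metric A u ** ?B) = ?B"
    by (simp add: matrix_mul_assoc)
  then show ?thesis
    by (simp add: 1)
qed

lemma partial_deriv_1 [simp]: "partial_deriv 1 (\<lambda>u :: real^2. f (u $ 2)) u = 0"
  by (simp add: partial_deriv_def)

lemma partial_deriv_2:
  "(f has_real_derivative D) (at (u $ 2)) \<Longrightarrow> partial_deriv 2 (\<lambda>u :: real^2. f (u $ 2)) u = D"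
  using DERIV_shift[of f D 0 "u $ 2"]
  by (simp add: partial_deriv_def DERIV_imp_deriv add.commute)

lemma partial_deriv_cong:
  assumes "open I" "u $ 2 \<in> I" "\<And>x. x $ 2 \<in> I \<Longrightarrow> f x = h x"
  shows "partial_deriv i f u = partial_deriv i h (u :: real^2)"
proof -
  have "open {s. (u + s *\<^sub>R axis i 1) $ 2 \<in> I}"
  proof -
    have "continuous_on UNIV (\<lambda>s :: real. (u + s *\<^sub>R axis i 1) $ 2)"
      by (intro continuous_intros)
    then show ?thesis
      using open_vimage[OF assms(1)] by (simp add: vimage_def)
  qed
  then have "\<forall>\<^sub>F s in nhds 0. (u + s *\<^sub>R axis i 1) $ 2 \<in> I"
    using assms(2) by (auto simp: eventually_nhds)
  then have "\<forall>\<^sub>F s in nhds 0. f (u + s *\<^sub>R axis i 1) = h (u + s *\<^sub>R axis i 1)"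
    by eventually_elim (rule assms(3))
  then show ?thesis
    unfolding partial_deriv_def by (intro deriv_cong_ev) auto
qed

lemma smooth_real_onD:
  assumes "smooth_real_on I f" "x \<in> I"
  shows "((deriv ^^ n) f has_real_derivative (deriv ^^ Suc n) f x) (at x)"
  using assms by (simp add: smooth_real_on_def real_differentiable_def DERIV_deriv_iff_real_differentiable)

lemma surface_of_revolution_deriv:
  assumes "surface_of_revolution I A" "x \<in> I"
  shows "(A has_real_derivative deriv A x) (at x)"
    and "(deriv A has_real_derivative deriv (deriv A) x) (at x)"
  using assms smooth_real_onD[of I A x 0] smooth_real_onD[of I A x 1]
  by (simp_all add: surface_of_revolution_def)

lemma revolution_christoffel:
  assumes "surface_of_revolution I A" "u \<in> revolution_points I"
  shows "christoffel (revolution_metric A) k i j u =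
    (if k = 1 \<and> i \<noteq> j then deriv A (u $ 2) / A (u $ 2)
     else if k = 2 \<and> i = 1 \<and> j = 1 then - (A (u $ 2) * deriv A (u $ 2)) else 0)"
proof -
  have u: "u $ 2 \<in> I" and pos: "A (u $ 2) > 0"
    using assms by (auto simp: surface_of_revolution_def revolution_points_def)
  have "((\<lambda>x. (A x)\<^sup>2) has_real_derivative 2 * A (u $ 2) * deriv A (u $ 2)) (at (u $ 2))"
    by (auto intro!: derivative_eq_intros surface_of_revolution_deriv(1)[OF assms(1) u])
  then have *: "partial_deriv 2 (\<lambda>x. (A (x $ 2))\<^sup>2) u = 2 * A (u $ 2) * deriv A (u $ 2)"
    by (rule partial_deriv_2)
  have c: "partial_deriv l (\<lambda>x. c) u = 0" for l :: 2 and c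
    by (simp add: partial_deriv_def)
  have 1: "partial_deriv 1 (\<lambda>x. (A (x $ 2))\<^sup>2) u = 0"
    by (rule partial_deriv_1)
  show ?thesis
    using exhaust_2[of i] exhaust_2[of j] exhaust_2[of k] pos
    by (auto simp: christoffel_def revolution_metric_inv sum_2 * c 1 field_simps)
      (simp_all add: power2_eq_square power4_eq_xxxx)
qed

lemma revolution_curvature:
  assumes "surface_of_revolution I A" "u \<in> revolution_points I"
  shows "gaussian_curvature (revolution_metric A) u = - deriv (deriv A) (u $ 2) / A (u $ 2)"
proof -
  let ?G = "christoffel (revolution_metric A)"
  have I: "open I" and u: "u $ 2 \<in> I" and pos: "A (u $ 2) > 0"
    using assms by (auto simp: surface_of_revolution_def revolution_points_def)
  note G = revolution_christoffel[OF assms(1)]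
  have "partial_deriv 2 (?G 1 1 2) u = partial_deriv 2 (\<lambda>x. deriv A (x $ 2) / A (x $ 2)) u"
    by (rule partial_deriv_cong[OF I u]) (simp add: G revolution_points_def)
  also have "\<dots> = (deriv (deriv A) (u $ 2) * A (u $ 2) - deriv A (u $ 2) * deriv A (u $ 2))
      / (A (u $ 2) * A (u $ 2))"
    using pos by (intro partial_deriv_2 DERIV_divide surface_of_revolution_deriv[OF assms(1) u]) auto
  finally have 2: "partial_deriv 2 (?G 1 1 2) u = \<dots>" .
  have "partial_deriv 1 (?G 1 2 2) u = partial_deriv 1 (\<lambda>x. 0) u"
    by (rule partial_deriv_cong[OF I u]) (simp add: G revolution_points_def)
  also have "\<dots> = 0" by (simp add: partial_deriv_def)
  finally show ?thesis
    using pos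
    by (simp add: gaussian_curvature_def riemann_def sum_2 det_2 G[OF assms(2)] 2 diff_divide_distrib)
qed

lemma flat_points_union_of_parallels:
  assumes "surface_of_revolution I A"
  shows "{u \<in> revolution_points I. gaussian_curvature (revolution_metric A) u = 0} =
           \<Union> (parallel ` {c \<in> I. deriv (deriv A) c = 0})"
    and "disjoint (parallel ` S)"
  using assms
  by (auto simp: revolution_curvature[OF assms] surface_of_revolution_def revolution_points_def
      parallel_def disjoint_def)

end

theory Submission
  imports Defs
begin

text \<open>
  Put \<open>v = d\<gamma>/dt\<close>, so that \<open>Q\<^sup>1 = A v\<^sup>1\<close> and \<open>Q\<^sup>2 = v\<^sup>2\<close>. In coordinates the equation reads
  \<open>dv\<^sup>1/dt = - 2 (A'/A) v\<^sup>1 v\<^sup>2 - C K v\<^sup>2 / A\<close> and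
  \<open>dv\<^sup>2/dt = A A' (v\<^sup>1)\<^sup>2 + C K A v\<^sup>1 - C\<^sup>2 K K'\<close>, and \<open>A'' = - K A\<close>. Substituting these, both
  \<open>A\<^sup>2 v\<^sup>1 - C A'\<close> (the Clairaut integral) and \<open>A\<^sup>2 (v\<^sup>1)\<^sup>2 + (v\<^sup>2)\<^sup>2 + C\<^sup>2 K\<^sup>2\<close> (the energy) have
  derivative zero along \<open>\<gamma>\<close>.
\<close>

lemma has_vector_derivative_vec_nth:
  assumes "(f has_vector_derivative D) F"
  shows "((\<lambda>t. f t $ i) has_real_derivative D $ i) F"
  using bounded_linear.has_vector_derivative[OF bounded_linear_vec_nth assms]
  by (simp add: has_real_derivative_iff_has_vector_derivative)

text \<open>The Gaussian curvature as a function of the second coordinate alone, so that K' is an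
  ordinary \<open>deriv\<close> and the chain rule along \<open>\<gamma>\<close> applies.\<close>

definition profile_curvature :: "(real \<Rightarrow> real) \<Rightarrow> real \<Rightarrow> real" where
  "profile_curvature A x = - deriv (deriv A) x / A x"

text \<open>K' involves the third derivative of \<open>A\<close>, which smoothness supplies on
  \<open>I\<close>; the quotient rule applies since \<open>A\<close> is positive there.\<close>

lemma profile_curvature_has_derivative:
  assumes "surface_of_revolution I A" "x \<in> I"
  shows "(profile_curvature A has_real_derivative deriv (profile_curvature A) x) (at x)"
proof -
  have "(deriv (deriv A) has_real_derivative deriv (deriv (deriv A)) x) (at x)"
    using assms smooth_real_onD[of I A x 2]
    by (simp add: surface_of_revolution_def eval_nat_numeral)
  moreover have "A x \<noteq> 0"
    using assms by (auto simp: surface_of_revolution_def)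
  ultimately have "profile_curvature A differentiable (at x)"
    unfolding profile_curvature_def [abs_def] real_differentiable_def
    using DERIV_divide[OF DERIV_minus surface_of_revolution_deriv(1)[OF assms]] by blast
  then show ?thesis
    by (simp add: DERIV_deriv_iff_real_differentiable)
qed

text \<open>The curvature depends only on the second coordinate, and the inverse metric is diagonal
  with second entry 1. The formula for the curvature holds only over \<open>I\<close>, so the
  partial derivatives are compared locally.\<close>

lemma gradient_revolution_curvature:
  assumes S: "surface_of_revolution I A" and u: "u \<in> revolution_points I"
  shows "gradient (revolution_metric A) (gaussian_curvature (revolution_metric A)) u
    = deriv (profile_curvature A) (u $ 2) *\<^sub>R axis 2 1"
proof -
  have I: "open I" "u $ 2 \<in> I" and pos: "A (u $ 2) > 0"
    using S u by (auto simp: surface_of_revolution_def revolution_points_def)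
  have "partial_deriv i (gaussian_curvature (revolution_metric A)) u
      = partial_deriv i (\<lambda>x. profile_curvature A (x $ 2)) u" for i
    by (rule partial_deriv_cong[OF I])
      (simp add: revolution_curvature[OF S] revolution_points_def profile_curvature_def)
  then show ?thesis
    using pos partial_deriv_2[OF profile_curvature_has_derivative[OF S I(2)]]
    by (simp add: gradient_def revolution_metric_inv vec_eq_iff forall_2 matrix_vector_mult_def sum_2)
qed

text \<open>The endpoints may be infinite, but the interval is convex, and a function with zero
  derivative on a convex set is constant.\<close>

lemma constant_on_einterval:
  fixes f :: "real \<Rightarrow> real"
  assumes "\<And>t. t \<in> einterval a b \<Longrightarrow> (f has_real_derivative 0) (at t)"
  obtains c where "\<And>t. t \<in> einterval a b \<Longrightarrow> f t = c"
proof -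
  have "convex (einterval a b)"
    unfolding einterval_def is_interval_convex_1[symmetric] is_interval_1
    by (auto intro: order_less_le_trans order_le_less_trans[OF ereal_less_eq(3)[THEN iffD2]])
  then show thesis
    using has_field_derivative_zero_constant[of "einterval a b" f] assms that
    by (blast intro: has_field_derivative_at_within)
qed

theorem corollary4p5p1:
  fixes I :: "real set" and A :: "real \<Rightarrow> real" and C :: real and a b :: ereal
    and \<gamma> :: "real \<Rightarrow> real^2" and Q1 Q2 :: "real \<Rightarrow> real"
    and M \<Sigma> :: "(real^2) set" and g :: "real^2 \<Rightarrow> real^2^2" and K :: "real^2 \<Rightarrow> real"
    and I1 :: "real set"
  assumes surface: "surface_of_revolution I A"
    and M: "M = revolution_points I"
    and g: "g = revolution_metric A"
    and K: "K = gaussian_curvature g"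
    and \<Sigma>: "\<Sigma> = {u \<in> M. K u = 0}"
    and ab: "a < b"
    and in_M: "\<And>t. t \<in> einterval a b \<Longrightarrow> \<gamma> t \<in> M"
    and diff1: "\<And>t. t \<in> einterval a b \<Longrightarrow> \<gamma> differentiable (at t)"
    and diff2: "\<And>t. t \<in> einterval a b \<Longrightarrow> velocity \<gamma> differentiable (at t)"
    and equation: "\<And>t. t \<in> einterval a b \<Longrightarrow>
      covariant_derivative g \<gamma> (velocity \<gamma>) t =
        (C * K (\<gamma> t)) *\<^sub>R complex_structure A (\<gamma> t) (velocity \<gamma> t)
        - (C\<^sup>2 * K (\<gamma> t)) *\<^sub>R gradient g K (\<gamma> t)"
    and I1: "I1 = {t \<in> einterval a b. \<gamma> t \<in> M - \<Sigma>}"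
    and dense: "einterval a b \<subseteq> closure I1"
    and Q: "\<And>t. t \<in> einterval a b \<Longrightarrow>
      velocity \<gamma> t = Q1 t *\<^sub>R frame1 A (\<gamma> t) + Q2 t *\<^sub>R frame2 (\<gamma> t)"
  shows "\<exists>C\<^sub>2 C\<^sub>3 :: real. \<forall>t \<in> einterval a b.
      A (\<gamma> t $ 2) * Q1 t - C * deriv A (\<gamma> t $ 2) = C\<^sub>2 \<and>
      (Q1 t)\<^sup>2 + (Q2 t)\<^sup>2 + C\<^sup>2 * (K (\<gamma> t))\<^sup>2 = C\<^sub>3\<^sup>2"
proof -
  let ?E = "einterval a b"
  define k where "k = profile_curvature A"
  define y where "y t = \<gamma> t $ 2" for t
  define v1 where "v1 t = velocity \<gamma> t $ 1" for t
  define v2 where "v2 t = velocity \<gamma> t $ 2" for t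
  define w where "w t = vector_derivative (velocity \<gamma>) (at t)" for t
  have yI: "y t \<in> I" if "t \<in> ?E" for t
    using in_M[OF that] by (simp add: M revolution_points_def y_def)
  have pos: "A (y t) > 0" if "t \<in> ?E" for t
    using surface yI[OF that] by (simp add: surface_of_revolution_def)
  have Kk: "K (\<gamma> t) = k (y t)" if "t \<in> ?E" for t
    using in_M[OF that]
    by (simp add: K g M revolution_curvature[OF surface] k_def profile_curvature_def y_def)
  \<comment> \<open>This turns the derivative of A' along the curve into a curvature term,
    comparable with those of the equation of motion.\<close>
  have A2: "deriv (deriv A) (y t) = - k (y t) * A (y t)" if "t \<in> ?E" for t
    using pos[OF that] by (simp add: k_def profile_curvature_def)
  have dy: "(y has_real_derivative v2 t) (at t)" if "t \<in> ?E" for t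
    using has_vector_derivative_vec_nth[OF vector_derivative_works[THEN iffD1, OF diff1[OF that]]]
    unfolding y_def v2_def velocity_def by blast
  have dv: "((\<lambda>t. velocity \<gamma> t $ i) has_real_derivative w t $ i) (at t)" if "t \<in> ?E" for t i
    using has_vector_derivative_vec_nth[OF vector_derivative_works[THEN iffD1, OF diff2[OF that]]]
    unfolding w_def by blast
  have eqn: "w t $ i + (\<Sum>j\<in>UNIV. \<Sum>l\<in>UNIV. christoffel (revolution_metric A) i j l (\<gamma> t)
        * velocity \<gamma> t $ j * velocity \<gamma> t $ l)
      = C * k (y t) * complex_structure A (\<gamma> t) (velocity \<gamma> t) $ i
        - C\<^sup>2 * k (y t) * deriv k (y t) * (axis 2 1 :: real^2) $ i" if "t \<in> ?E" for t i
  proof -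
    have "\<gamma> t \<in> revolution_points I"
      using in_M[OF that] by (simp add: M)
    from gradient_revolution_curvature[OF surface this]
    have "gradient g K (\<gamma> t) = deriv k (y t) *\<^sub>R axis 2 1"
      by (simp add: K g k_def y_def)
    then show ?thesis
      using arg_cong[OF equation[OF that], of "\<lambda>x. x $ i"]
      by (simp add: covariant_derivative_def Kk[OF that] g w_def)
  qed
  \<comment> \<open>The factor 2 collects the two equal symbols with mixed lower indices; the last
    term is the first coordinate of J applied to the velocity, times C K.\<close>
  have w1: "w t $ 1 = - 2 * deriv A (y t) / A (y t) * v1 t * v2 t - C * k (y t) * v2 t / A (y t)"
    and w2: "w t $ 2 = A (y t) * deriv A (y t) * (v1 t)\<^sup>2 + C * k (y t) * A (y t) * v1 t
      - C\<^sup>2 * k (y t) * deriv k (y t)" if "t \<in> ?E" for t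
  proof -
    have u: "\<gamma> t \<in> revolution_points I"
      using in_M[OF that] by (simp add: M)
    note simps = sum_2 revolution_christoffel[OF surface u] complex_structure_def metric_inner_def
      frame1_def frame2_def v1_def[symmetric] v2_def[symmetric] y_def[symmetric]
    show "w t $ 1 = - 2 * deriv A (y t) / A (y t) * v1 t * v2 t - C * k (y t) * v2 t / A (y t)"
      using eqn[OF that, of 1] pos[OF that] by (simp add: simps algebra_simps)
    show "w t $ 2 = A (y t) * deriv A (y t) * (v1 t)\<^sup>2 + C * k (y t) * A (y t) * v1 t
      - C\<^sup>2 * k (y t) * deriv k (y t)"
      using eqn[OF that, of 2] pos[OF that] by (simp add: simps power2_eq_square algebra_simps)
  qed
  have dv1: "(v1 has_real_derivative w t $ 1) (at t)" and dv2: "(v2 has_real_derivative w t $ 2) (at t)"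
    if "t \<in> ?E" for t
    using dv[OF that] by (simp_all add: v1_def [abs_def] v2_def [abs_def])
  have dA: "((\<lambda>t. A (y t)) has_real_derivative deriv A (y t) * v2 t) (at t)"
    and dA': "((\<lambda>t. deriv A (y t)) has_real_derivative - k (y t) * A (y t) * v2 t) (at t)"
    and dk: "((\<lambda>t. k (y t)) has_real_derivative deriv k (y t) * v2 t) (at t)" if "t \<in> ?E" for t
    using DERIV_chain2[OF surface_of_revolution_deriv(1)[OF surface yI[OF that]] dy[OF that]]
      DERIV_chain2[OF surface_of_revolution_deriv(2)[OF surface yI[OF that]] dy[OF that]]
      DERIV_chain2[OF profile_curvature_has_derivative[OF surface yI[OF that]] dy[OF that]]
    by (simp_all add: A2[OF that] k_def)
  \<comment> \<open>The Christoffel term cancels the derivative of A^2, leaving - C K A v2 from the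
    J term; the derivative of - C A' is its opposite.\<close>
  have "((\<lambda>t. (A (y t))\<^sup>2 * v1 t - C * deriv A (y t)) has_real_derivative 0) (at t)"
    if "t \<in> ?E" for t
    using pos[OF that]
    by (auto intro!: derivative_eq_intros dA[OF that] dA'[OF that] dv1[OF that] simp: w1[OF that])
      (simp add: field_simps power2_eq_square)
  then obtain C\<^sub>2 where C2: "\<And>t. t \<in> ?E \<Longrightarrow> (A (y t))\<^sup>2 * v1 t - C * deriv A (y t) = C\<^sub>2"
    using constant_on_einterval by blast
  \<comment> \<open>Three cancellations: the Christoffel terms against the derivative of the metric,
    the J terms because Jv is orthogonal to v, and the gradient term against the derivative of C^2
    K^2.\<close>
  have "((\<lambda>t. (A (y t) * v1 t)\<^sup>2 + (v2 t)\<^sup>2 + C\<^sup>2 * (k (y t))\<^sup>2) has_real_derivative 0) (at t)"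
    if "t \<in> ?E" for t
    using pos[OF that]
    by (auto intro!: derivative_eq_intros dA[OF that] dk[OF that] dv1[OF that] dv2[OF that]
        simp: w1[OF that] w2[OF that])
      (simp add: field_simps power2_eq_square)
  then obtain c where c: "\<And>t. t \<in> ?E \<Longrightarrow> (A (y t) * v1 t)\<^sup>2 + (v2 t)\<^sup>2 + C\<^sup>2 * (k (y t))\<^sup>2 = c"
    using constant_on_einterval by blast
  have Q1: "Q1 t = A (y t) * v1 t" and Q2: "Q2 t = v2 t" if "t \<in> ?E" for t
    using pos[OF that] Q[OF that] by (simp_all add: v1_def v2_def frame1_def frame2_def y_def)
  \<comment> \<open>At any point of the interval \<open>c\<close> is a sum of squares, hence
    nonnegative, so \<open>sqrt c\<close> can serve as the second constant.\<close>
  have "c = (sqrt c)\<^sup>2" if "t \<in> ?E" for t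
    using c[OF that] by (smt (verit) real_sqrt_pow2 zero_le_power2 zero_le_mult_iff)
  then show ?thesis
    using C2 c
    by (intro exI[of _ C\<^sub>2] exI[of _ "sqrt c"])
      (auto simp: Q1 Q2 Kk y_def[symmetric] power2_eq_square mult.assoc)
qed

end
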